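(* Let $\mathcal{Y}$ be an $m\times n$ zero-nonzero pattern, let $G$ be the cobipartite graph associated with $\mathcal{Y}$, and suppose $G$ is saturated with respect to the corresponding clique partition. Then, over an infinite field, the following are equivalent: (1) $\operatorname{mr}(\mathcal{Y})=\operatorname{tri}(\mathcal{Y})$; (2) $M(G)=Z(G)$; (3) $M(G)=\hat Z(G)$. In addition, over $\mathbb R$, these statements are equivalent to $M_+(G)=Z_+(G)$.
   Context: A zero-nonzero pattern is a matrix with entries in $\{0,*\}$; $\operatorname{mr}(\mathcal{Y})$ (over the field $\mathbb F$) is the smallest rank of a matrix over $\mathbb F$ whose nonzero entries are exactly at the $*$ positions of $\mathcal{Y}$. A square pattern is a triangle if some row permutation followed by some independent column permutation yields a lower-triangular pattern with only $*$ on the diagonal; $\operatorname{tri}(\mathcal{Y})$ is the largest size of a triangle submatrix of $\mathcal{Y}$. For a simple graph $G$, $\mathcal S(G,\mathbb F)$ is the set of symmetric matrices over $\mathbb F$ with off-diagonal $(i,j)$ entry nonzero iff $\{i,j\}\in E(G)$ (diagonal arbitrary); $M(G)$ is the maximum nullity over $\mathcal S(G,\mathbb F)$, and $M_+(G)$ is the maximum nullity over the positive semidefinite matrices in $\mathcal S(G,\mathbb R)$. The cobipartite graph associated with $\mathcal{Y}$ has vertex set $V_r\cup V_c$, $|V_r|=m$, $|V_c|=n$, each a clique, with $r_i\sim c_j$ iff $\mathcal{Y}_{ij}=*$; it is saturated with respect to $(V_r,V_c)$ if every vertex of each part has a neighbor in the other part. $Z(G)$: smallest size of an initially filled set from which repeatedly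 "a filled vertex with exactly one unfilled neighbor $u$ forces $u$" fills all vertices. $Z_+(G)$: same but with the rule "after deleting filled vertices, if a filled vertex $v$ has exactly one neighbor $u$ in some connected component of the remaining subgraph, $v$ forces $u$". A looping of $G$ adds loops to some vertices; in a loop graph, any vertex (filled or not) whose unique unfilled neighbor is $u$ (a looped vertex is its own neighbor) may force $u$; the zero forcing number of a loop graph is the smallest set from which this rule fills all vertices; $\hat Z(G)$ is the maximum of this over all loopings of $G$. *)

theory Defs
  imports "HOL-Analysis.Analysis"
begin

text \<open>An \<open>m \<times> n\<close> pattern; the entry \<open>True\<close> stands for \<open>*\<close> and \<open>False\<close> for \<open>0\<close>.\<close>

type_synonym ('m, 'n) pattern = "bool ^ 'n ^ 'm"

definition has_pattern :: "'a::zero ^ 'n::finite ^ 'm::finite \<Rightarrow> ('m::finite, 'n::finite) pattern \<Rightarrow> bool" where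
  "has_pattern A Y \<longleftrightarrow> (\<forall>i j. A $ i $ j \<noteq> 0 \<longleftrightarrow> Y $ i $ j)"

definition min_rank :: "'a::field itself \<Rightarrow> ('m::finite, 'n::finite) pattern \<Rightarrow> nat" where
  "min_rank _ Y = (LEAST r. \<exists>A :: 'a ^ 'n ^ 'm. has_pattern A Y \<and> rank A = r)"

text \<open>The square submatrix of \<open>Y\<close> with row set \<open>R\<close> and column set \<open>C\<close> is a triangle.  The index
  types carry no order, so a row (column) permutation of the submatrix is an enumeration
  \<open>\<rho>\<close> (\<open>\<sigma>\<close>) of its rows (columns).\<close>

definition triangle :: "('m::finite, 'n::finite) pattern \<Rightarrow> 'm set \<Rightarrow> 'n set \<Rightarrow> bool" where
  "triangle Y R C \<longleftrightarrow> card R = card C \<and>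
    (\<exists>\<rho> \<sigma>. bij_betw \<rho> {..<card R} R \<and> bij_betw \<sigma> {..<card C} C \<and>
      (\<forall>i<card R. Y $ \<rho> i $ \<sigma> i) \<and>
      (\<forall>i<card R. \<forall>j<card C. i < j \<longrightarrow> \<not> Y $ \<rho> i $ \<sigma> j))"

definition tri :: "('m::finite, 'n::finite) pattern \<Rightarrow> nat" where
  "tri Y = Max {card R | R C. triangle Y R C}"

text \<open>A graph on the vertex set \<open>'v\<close> is given by its adjacency relation; it is simple if the
  relation is symmetric and irreflexive, and a loop at \<open>v\<close> is \<open>G v v\<close>.\<close>

type_synonym 'v graph = "'v \<Rightarrow> 'v \<Rightarrow> bool"

definition sym_matrices :: "'v::finite graph \<Rightarrow> ('a::zero ^ 'v ^ 'v) set" where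
  "sym_matrices G = {A. transpose A = A \<and> (\<forall>i j. i \<noteq> j \<longrightarrow> (A $ i $ j \<noteq> 0 \<longleftrightarrow> G i j))}"

definition nullity :: "'a::field ^ 'n::finite ^ 'm::finite \<Rightarrow> nat" where
  "nullity A = vec.dim {x. A *v x = 0}"

definition pos_semidef :: "real ^ 'v::finite ^ 'v \<Rightarrow> bool" where
  "pos_semidef A \<longleftrightarrow> transpose A = A \<and> (\<forall>x. 0 \<le> x \<bullet> (A *v x))"

definition max_nullity :: "'a::field itself \<Rightarrow> 'v::finite graph \<Rightarrow> nat" where
  "max_nullity _ G = Max {nullity A | A :: 'a ^ 'v ^ 'v. A \<in> sym_matrices G}"

definition max_psd_nullity :: "'v::finite graph \<Rightarrow> nat" where
  "max_psd_nullity G = Max {nullity A | A :: real ^ 'v ^ 'v. A \<in> sym_matrices G \<and> pos_semidef A}"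

text \<open>The row vertices are \<open>Inl i\<close> and the column vertices are \<open>Inr j\<close>.\<close>

fun cobipartite_graph :: "('m::finite, 'n::finite) pattern \<Rightarrow> ('m + 'n) graph" where
  "cobipartite_graph Y (Inl i) (Inl i') \<longleftrightarrow> i \<noteq> i'"
| "cobipartite_graph Y (Inr j) (Inr j') \<longleftrightarrow> j \<noteq> j'"
| "cobipartite_graph Y (Inl i) (Inr j) \<longleftrightarrow> Y $ i $ j"
| "cobipartite_graph Y (Inr j) (Inl i) \<longleftrightarrow> Y $ i $ j"

lemma symp_cobipartite_graph: "symp (cobipartite_graph Y)"
proof (rule sympI)
  fix u v
  show "cobipartite_graph Y u v \<Longrightarrow> cobipartite_graph Y v u"
    by (cases u; cases v) auto
qed

lemma irreflp_cobipartite_graph: "irreflp (cobipartite_graph Y)"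
proof (rule irreflpI)
  fix v
  show "\<not> cobipartite_graph Y v v"
    by (cases v) auto
qed

definition saturated :: "'v graph \<Rightarrow> 'v set \<Rightarrow> 'v set \<Rightarrow> bool" where
  "saturated G V W \<longleftrightarrow> (\<forall>v\<in>V. \<exists>w\<in>W. G v w) \<and> (\<forall>w\<in>W. \<exists>v\<in>V. G w v)"

text \<open>A forcing rule \<open>f\<close> states by \<open>f F v u\<close> that \<open>v\<close> may force \<open>u\<close> when \<open>F\<close> is the
  set of filled vertices.\<close>

type_synonym 'v forcing_rule = "'v set \<Rightarrow> 'v \<Rightarrow> 'v \<Rightarrow> bool"

definition forcing_step :: "'v forcing_rule \<Rightarrow> 'v set \<Rightarrow> 'v set \<Rightarrow> bool" where
  "forcing_step f F F' \<longleftrightarrow> (\<exists>v u. f F v u \<and> F' = insert u F)"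

definition forcing_number :: "'v::finite forcing_rule \<Rightarrow> nat" where
  "forcing_number f = (LEAST k. \<exists>S. card S = k \<and> (forcing_step f)\<^sup>*\<^sup>* S UNIV)"

definition standard_rule :: "'v graph \<Rightarrow> 'v forcing_rule" where
  "standard_rule G F v u \<longleftrightarrow> v \<in> F \<and> {w. w \<notin> F \<and> G v w} = {u}"

definition zero_forcing_number :: "'v::finite graph \<Rightarrow> nat" where
  "zero_forcing_number G = forcing_number (standard_rule G)"

text \<open>The vertex sets of the connected components of the subgraph induced by \<open>U\<close>.\<close>

definition induced_components :: "'v graph \<Rightarrow> 'v set \<Rightarrow> 'v set set" where
  "induced_components G U =
    {{y. (\<lambda>a b. a \<in> U \<and> b \<in> U \<and> G a b)\<^sup>*\<^sup>* x y} | x. x \<in> U}"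

definition psd_rule :: "'v graph \<Rightarrow> 'v forcing_rule" where
  "psd_rule G F v u \<longleftrightarrow>
    v \<in> F \<and> (\<exists>W \<in> induced_components G (- F). {w \<in> W. G v w} = {u})"

definition psd_zero_forcing_number :: "'v::finite graph \<Rightarrow> nat" where
  "psd_zero_forcing_number G = forcing_number (psd_rule G)"

text \<open>In a loop graph the forcing vertex need not be filled, and it may force itself.\<close>

definition loop_rule :: "'v graph \<Rightarrow> 'v forcing_rule" where
  "loop_rule H F v u \<longleftrightarrow> {w. w \<notin> F \<and> H v w} = {u}"

definition looping :: "'v graph \<Rightarrow> 'v set \<Rightarrow> 'v graph" where
  "looping G L u v \<longleftrightarrow> G u v \<or> (u = v \<and> u \<in> L)"

definition enhanced_zero_forcing_number :: "'v::finite graph \<Rightarrow> nat" where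
  "enhanced_zero_forcing_number G =
    Max {forcing_number (loop_rule (looping G L)) | L :: 'v set. True}"

end

theory Submission
  imports Defs
begin

text \<open>All quantities are determined by \<open>Y\<close>. Let \<open>N = m + n\<close>.

  Maximum nullities equal \<open>N - mr(Y)\<close>. The off-diagonal block of a matrix of the graph has
  pattern \<open>Y\<close>, so its rank is at least \<open>mr(Y)\<close>. Conversely, a rank factorization \<open>B = P Q\<close> of
  a matrix with pattern \<open>Y\<close> gives the symmetric matrix \<open>[P D; Q\<^sup>T] D\<^sup>-\<^sup>1 [D P\<^sup>T, Q]\<close> of the same
  rank with block \<open>B\<close>, where \<open>D = diag(t, 1, ..., 1)\<close>. Since \<open>B\<close> has no zero row or column,
  the factorization can be chosen such that the first column of \<open>P\<close> and the first row of \<open>Q\<close>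
  have no zero entry, and then all but finitely many \<open>t\<close> make the diagonal blocks entrywise
  nonzero. Over the reals any \<open>t > 0\<close> gives a positive semidefinite matrix.

  All forcing numbers equal \<open>N - tri(Y)\<close>. If all rows, and all columns outside a triangle, are
  filled, then the rows of the triangle force its columns one by one, under each of the rules.
  Conversely, a forcing process gives a triangle with as many rows as there are initially unfilled
  vertices: a force between the two cliques contributes its pair of row and column, and a force
  inside a clique happens only to the last unfilled vertex of that clique, where saturation provides
  a replacement for one of the two vertices.\<close>

section \<open>Rank and nullity over an arbitrary field\<close>

lemma rank_nullity:
  fixes A :: "'a::field^'n::finite^'m::finite"
  shows "nullity A + vec.dim (range ((*v) A)) = CARD('n)"
proof -
  let ?K = "{x. A *v x = 0}"
  obtain K where K: "K \<subseteq> ?K" "vec.independent K" "?K \<subseteq> vec.span K" "card K = vec.dim ?K"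
    using vec.basis_exists by metis
  have finK: "finite K" using K(2) vec.finiteI_independent by blast
  define C where "C = vec.extend_basis K"
  have C: "K \<subseteq> C" "vec.independent C" "vec.span C = UNIV"
    unfolding C_def using K(2)
    by (auto simp: vec.extend_basis_superset vec.independent_extend_basis)
  have finC: "finite C" using C(2) vec.finiteI_independent by blast
  have cardC: "card C = CARD('n)"
    using vec.dim_eq_card[of C UNIV] C by (simp add: card_cart_basis)
  have "range ((*v) A) = vec.span ((*v) A ` C)"
    by (simp add: vec.span_image C(3))
  \<comment> \<open>Vectors of \<open>K\<close> map to 0, so the images of \<open>C - K\<close>
    already span the range; this bounds its dimension from above.\<close>
  also have "\<dots> \<subseteq> vec.span ((*v) A ` (C - K))"
  proof (rule vec.span_minimal)
    show "(*v) A ` C \<subseteq> vec.span ((*v) A ` (C - K))"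
    proof (rule image_subsetI)
      fix x assume "x \<in> C"
      show "A *v x \<in> vec.span ((*v) A ` (C - K))"
      proof (cases "x \<in> K")
        case True
        then have "A *v x = 0" using K(1) by blast
        then show ?thesis by (simp add: vec.span_zero)
      next
        case False
        with \<open>x \<in> C\<close> show ?thesis by (intro vec.span_base imageI) simp
      qed
    qed
  qed simp
  finally have "vec.dim (range ((*v) A)) \<le> card ((*v) A ` (C - K))"
    by (rule vec.dim_le_card) (use finC in simp)
  also have "\<dots> \<le> card (C - K)" by (rule card_image_le) (use finC in simp)
  also have "\<dots> = CARD('n) - nullity A"
    using C(1) finK K(4) cardC by (simp add: card_Diff_subset nullity_def)
  finally have le: "vec.dim (range ((*v) A)) \<le> CARD('n) - nullity A" .
  have Kle: "nullity A \<le> CARD('n)"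
    using C(1) finC K(4) cardC card_mono by (metis nullity_def)
  obtain R where R: "R \<subseteq> range ((*v) A)" "vec.independent R" "range ((*v) A) \<subseteq> vec.span R"
      "card R = vec.dim (range ((*v) A))"
    using vec.basis_exists by metis
  have finR: "finite R" using R(2) vec.finiteI_independent by blast
  obtain g where g: "\<And>b. b \<in> R \<Longrightarrow> A *v g b = b"
    using R(1) by (metis f_inv_into_f subsetD)
  \<comment> \<open>For the reverse bound, \<open>x\<close> differs only by a kernel vector from the
    combination of the preimages \<open>g b\<close> that has the same image.\<close>
  have "UNIV \<subseteq> vec.span (K \<union> g ` R)"
  proof
    fix x :: "'a^'n"
    have "A *v x \<in> vec.span R" using R(3) by auto
    also have "R = (*v) A ` g ` R" using g by (auto simp: image_image)
    finally obtain y where y: "y \<in> vec.span (g ` R)" "A *v x = A *v y"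
      unfolding vec.span_image by auto
    have "x - y \<in> vec.span K" using K(3) y(2) by (auto simp: vec.diff)
    then have "x - y + y \<in> vec.span (K \<union> g ` R)"
      using y(1) by (intro vec.span_add) (auto intro: vec.span_mono[THEN subsetD, rotated])
    then show "x \<in> vec.span (K \<union> g ` R)" by simp
  qed
  then have "vec.dim (UNIV :: ('a^'n) set) \<le> card (K \<union> g ` R)"
    by (rule vec.dim_le_card) (use finK finR in simp)
  also have "\<dots> \<le> nullity A + vec.dim (range ((*v) A))"
    using card_Un_le[of K "g ` R"] card_image_le[OF finR, of g] K(4) R(4)
    by (simp add: nullity_def)
  finally show ?thesis using le Kle by (simp add: card_cart_basis)
qed

lemma columns_eq_image_axis: "columns A = range (\<lambda>j. A *v axis j (1 :: 'a::field))"
proof -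
  have "A *v axis j 1 = column j A" for j
    by (simp add: vec_eq_iff matrix_vector_mult_def column_def axis_def if_distrib cong: if_cong)
  then show ?thesis by (auto simp: columns_def)
qed

text \<open>\<open>rank\<close> is the dimension of the row space, whereas
  \<open>rank_nullity\<close> involves the column space; symmetry makes rows and columns
  coincide.\<close>

lemma nullity_symmetric:
  fixes A :: "'a::field^'v::finite^'v"
  assumes "transpose A = A"
  shows "nullity A + rank A = CARD('v)"
proof -
  have "rows A = columns A" using assms by (metis columns_transpose)
  moreover have "range ((*v) A) \<subseteq> vec.span (columns A)"
    by (auto simp: matrix_vector_mult_in_columnspace_gen)
  moreover have "columns A \<subseteq> range ((*v) A)"
    by (auto simp: columns_eq_image_axis)
  ultimately have "vec.dim (range ((*v) A)) = rank A"
    unfolding row_rank_def_gen by (metis le_antisym vec.dim_mono vec.dim_subset)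
  then show ?thesis using rank_nullity[of A] by simp
qed

text \<open>Restricting vectors to the \<open>Inr\<close> coordinates is linear and maps row
  \<open>Inl i\<close> of \<open>A\<close> to row \<open>i\<close> of \<open>B\<close>.\<close>

lemma rank_off_diagonal_block_le:
  fixes A :: "'a::field^('m::finite + 'n::finite)^('m + 'n)" and B :: "'a^'n^'m"
  assumes "\<And>i j. A $ Inl i $ Inr j = B $ i $ j"
  shows "rank B \<le> rank A"
proof -
  let ?f = "\<lambda>x :: 'a^('m + 'n). (\<chi> j. x $ Inr j) :: 'a^'n"
  have lin: "Vector_Spaces.linear (*s) (*s) ?f"
    by (unfold_locales) (simp_all add: vec_eq_iff algebra_simps)
  have "row i B = ?f (row (Inl i) A)" for i
    by (simp add: row_def vec_eq_iff assms)
  then have "rows B \<subseteq> ?f ` rows A" by (auto simp: rows_def)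
  then have "vec.dim (rows B) \<le> vec.dim (?f ` rows A)" by (rule vec.dim_subset)
  also have "\<dots> \<le> vec.dim (rows A)" by (rule vec.dim_image_le[OF lin])
  finally show ?thesis by (simp add: row_rank_def_gen)
qed

section \<open>Avoiding hyperplanes, and Gram-type matrices\<close>

definition dot :: "'a::field^'n::finite \<Rightarrow> 'a^'n \<Rightarrow> 'a" where
  "dot x y = (\<Sum>j\<in>UNIV. x $ j * y $ j)"

lemma dot_add_left: "dot (x + y) z = dot x z + dot y z"
  and dot_add_right: "dot z (x + y) = dot z x + dot z y"
  and dot_scale_left: "dot (c *s x) z = c * dot x z"
  and dot_scale_right: "dot z (c *s x) = c * dot z x"
  by (simp_all add: dot_def algebra_simps sum.distrib sum_distrib_left)

lemma dot_axis: "dot x (axis j 1) = x $ j"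
  by (simp add: dot_def axis_def if_distrib cong: if_cong)

lemma infinite_avoids_finite:
  assumes "infinite X" "finite T"
  obtains t where "t \<in> X" "t \<notin> T"
  using assms by (meson finite_subset subsetI)

text \<open>A space over an infinite field is not a finite union of hyperplanes. In the induction
  step the old \<open>w\<close> is moved along an axis not orthogonal to \<open>v k\<close>.\<close>

lemma exists_dot_nonzero:
  fixes v :: "'i \<Rightarrow> 'a::field^'n::finite"
  assumes inf: "infinite (UNIV :: 'a set)" and "finite I" and "\<And>i. i \<in> I \<Longrightarrow> v i \<noteq> 0"
  shows "\<exists>w. \<forall>i\<in>I. dot (v i) w \<noteq> 0"
  using assms(2,3)
proof (induction I rule: finite_induct)
  case empty
  then show ?case by simp
next
  case (insert k I)
  then obtain w where w: "\<And>i. i \<in> I \<Longrightarrow> dot (v i) w \<noteq> 0" by auto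
  obtain j where j: "v k $ j \<noteq> 0" using insert.prems[of k] by (auto simp: vec_eq_iff)
  define e where "e = (axis j 1 :: 'a^'n)"
  have e: "dot (v k) e \<noteq> 0" using j by (simp add: e_def dot_axis)
  \<comment> \<open>The roots in \<open>t\<close> of the affine functions
    \<open>dot (v i) (w + t *s e)\<close>. Where the slope vanishes the quotient is 0, which merely
    excludes one more value.\<close>
  let ?T = "(\<lambda>i. - dot (v i) w / dot (v i) e) ` insert k I"
  have "finite ?T" using insert.hyps(1) by simp
  from infinite_avoids_finite[OF inf this] obtain t where t: "t \<notin> ?T" by blast
  have "dot (v i) (w + t *s e) \<noteq> 0" if "i \<in> insert k I" for i
  proof (cases "dot (v i) e = 0")
    case True
    with e w that show ?thesis by (auto simp: dot_add_right dot_scale_right)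
  next
    case False
    have "t \<noteq> - dot (v i) w / dot (v i) e" using t(1) that by blast
    with False have "dot (v i) w + t * dot (v i) e \<noteq> 0"
      by (metis add_eq_0_iff eq_divide_eq)
    then show ?thesis by (simp add: dot_add_right dot_scale_right)
  qed
  then show ?case by blast
qed

text \<open>The matrix \<open>d y y^T\<close> plus the sum of all \<open>z b (z b)^T\<close>. The
  weight \<open>d\<close> stays outside the vectors because it may have no square root in the
  field.\<close>

definition gram :: "'a::field \<Rightarrow> 'a^'v::finite \<Rightarrow> 'b set \<Rightarrow> ('b \<Rightarrow> 'a^'v) \<Rightarrow> 'a^'v^'v" where
  "gram d y S z = (\<chi> k l. d * y $ k * y $ l + (\<Sum>b\<in>S. z b $ k * z b $ l))"

lemma transpose_gram: "transpose (gram d y S z) = gram d y S z"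
  by (simp add: gram_def transpose_def vec_eq_iff mult_ac)

lemma gram_mult_vec: "gram d y S z *v x = (d * dot y x) *s y + (\<Sum>b\<in>S. dot (z b) x *s z b)"
proof -
  have "(\<Sum>l\<in>UNIV. (\<Sum>b\<in>S. z b $ k * z b $ l) * x $ l) = (\<Sum>b\<in>S. dot (z b) x * z b $ k)" for k
    unfolding sum_distrib_right dot_def by (subst sum.swap) (simp add: mult_ac)
  then show ?thesis
    by (simp add: gram_def vec_eq_iff matrix_vector_mult_def distrib_right sum.distrib)
      (simp add: sum_distrib_left sum_distrib_right dot_def mult_ac)
qed

lemma nullity_gram:
  fixes y :: "'a::field^'v::finite"
  assumes "finite S"
  shows "CARD('v) \<le> nullity (gram d y S z) + Suc (card S)"
proof -
  have "gram d y S z *v x \<in> vec.span (insert y (z ` S))" for x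
    unfolding gram_mult_vec
    by (intro vec.span_add vec.span_scale vec.span_sum vec.span_base) auto
  then have "vec.dim (range ((*v) (gram d y S z))) \<le> card (insert y (z ` S))"
    using assms by (intro vec.dim_le_card) auto
  also have "\<dots> \<le> Suc (card S)"
    using card_image_le[OF assms, of z] assms by (simp add: card_insert_if)
  finally show ?thesis using rank_nullity[of "gram d y S z"] by linarith
qed

lemma pos_semidef_gram:
  fixes y :: "real^'v::finite"
  assumes "0 \<le> d"
  shows "pos_semidef (gram d y S z)"
proof -
  have "inner x (gram d y S z *v x) = d * (dot y x)\<^sup>2 + (\<Sum>b\<in>S. (dot (z b) x)\<^sup>2)" for x
  proof -
    have d: "inner x v = dot v x" for v by (simp add: inner_vec_def dot_def mult_ac)
    show ?thesis
      unfolding gram_mult_vec inner_add_right inner_sum_right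
      by (simp add: d dot_scale_left power2_eq_square mult_ac)
  qed
  then show ?thesis using assms
    by (auto simp: pos_semidef_def transpose_gram intro!: add_nonneg_nonneg sum_nonneg)
qed

text \<open>Write \<open>B\<close> as \<open>p r^T\<close> plus one rank one term for each element
  of \<open>S\<close>, with \<open>p\<close> and \<open>r\<close> free of zeros. Replacing
  \<open>p\<close> by \<open>t p\<close> and weighting by \<open>1/t\<close> fixes the block
  \<open>B\<close> but varies the diagonal blocks. The set \<open>X\<close> allows \<open>t\<close>
  to be kept positive over the reals.\<close>

lemma exists_gram_with_block:
  fixes B :: "'a::field^'n::finite^'m::finite" and X :: "'a set"
  assumes inf: "infinite X" and rows: "\<And>i. row i B \<noteq> 0" and columns: "\<And>j. column j B \<noteq> 0"
  obtains t :: 'a and y :: "'a^('m + 'n)" and S :: "('a^'n) set" and z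
  where "t \<in> X" "finite S" "Suc (card S) \<le> rank B"
    "\<And>i j. gram (inverse t) y S z $ Inl i $ Inr j = B $ i $ j"
    "\<And>i i'. gram (inverse t) y S z $ Inl i $ Inl i' \<noteq> 0"
    "\<And>j j'. gram (inverse t) y S z $ Inr j $ Inr j' \<noteq> 0"
proof -
  have infU: "infinite (UNIV :: 'a set)" by (rule infinite_super[OF subset_UNIV inf])
  \<comment> \<open>With \<open>a\<close> off the hyperplanes orthogonal to the columns,
    \<open>r\<close> is a combination of the rows of \<open>B\<close> without zero entries.\<close>
  obtain a where a: "\<And>j. dot (column j B) a \<noteq> 0"
    using exists_dot_nonzero[OF infU, of UNIV "\<lambda>j. column j B"] columns by auto
  define r where "r = (\<chi> j. dot (column j B) a)"
  have r_nz: "r $ j \<noteq> 0" for j by (simp add: r_def a)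
  have "r = (\<Sum>i\<in>UNIV. a $ i *s row i B)"
    by (simp add: vec_eq_iff r_def dot_def column_def row_def mult.commute)
  moreover have row_span: "row i B \<in> vec.span (rows B)" for i
    by (rule vec.span_base) (auto simp: rows_def)
  ultimately have r_span: "r \<in> vec.span (rows B)"
    by (simp add: vec.span_sum vec.span_scale)
  have "r \<noteq> 0" using r_nz by (metis zero_index)
  \<comment> \<open>A single \<open>w\<close> is chosen for \<open>r\<close> (index
    \<open>None\<close>) and all rows (\<open>Some i\<close>).\<close>
  then have "\<exists>w. \<forall>q\<in>UNIV. dot (case q of None \<Rightarrow> r | Some i \<Rightarrow> row i B) w \<noteq> 0"
    using rows by (intro exists_dot_nonzero[OF infU]) (auto split: option.split)
  then obtain w where w: "dot (case q of None \<Rightarrow> r | Some i \<Rightarrow> row i B) w \<noteq> 0" for q by blast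
  have rw: "dot r w \<noteq> 0" using w[of None] by simp
  have roww: "dot (row i B) w \<noteq> 0" for i using w[of "Some i"] by simp
  \<comment> \<open>The coefficient that makes \<open>row i B - p i *s r\<close> orthogonal to
    \<open>w\<close>.\<close>
  define p where "p i = dot (row i B) w / dot r w" for i
  have p_nz: "p i \<noteq> 0" for i using rw roww by (simp add: p_def)
  \<comment> \<open>Wedderburn rank reduction: subtracting the rank one matrix \<open>p r\<^sup>T\<close> from \<open>B\<close> moves all rows
    into the hyperplane orthogonal to \<open>w\<close>, which lowers the rank.\<close>
  define c where "c i = row i B - p i *s r" for i
  have c_row: "row i B = p i *s r + c i" for i by (simp add: c_def)
  have "dot (c i) w = 0" for i
  proof -
    have "dot (row i B) w = p i * dot r w + dot (c i) w"
      by (subst c_row) (simp add: dot_add_left dot_scale_left)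
    then show ?thesis using rw by (simp add: p_def)
  qed
  then have "vec.span (range c) \<subseteq> {x. dot x w = 0}"
    by (intro vec.span_minimal)
      (auto simp: vec.subspace_def dot_add_left dot_scale_left, simp add: dot_def)
  then have "r \<notin> vec.span (range c)" using rw by auto
  moreover have "range c \<subseteq> vec.span (rows B)"
    using r_span row_span by (auto simp: c_def intro!: vec.span_diff vec.span_scale)
  then have "vec.span (range c) \<subseteq> vec.span (rows B)"
    by (intro vec.span_minimal) auto
  ultimately have "vec.span (range c) \<subset> vec.span (rows B)" using r_span by blast
  then have less: "vec.dim (range c) < rank B"
    unfolding row_rank_def_gen by (rule vec.dim_psubset)
  obtain S where S: "S \<subseteq> range c" "vec.independent S" "range c \<subseteq> vec.span S"
      "card S = vec.dim (range c)"
    using vec.basis_exists by metis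
  have finS: "finite S" using S(2) vec.finiteI_independent by blast
  have "\<forall>i. \<exists>k. c i = (\<Sum>b\<in>S. k b *s b)"
    using S(3) unfolding vec.span_finite[OF finS] by auto
  then obtain k where k: "\<And>i. c i = (\<Sum>b\<in>S. k i b *s b)" by metis
  define E where "E i i' = (\<Sum>b\<in>S. k i b * k i' b)" for i i'
  define F where "F j j' = (\<Sum>b\<in>S. b $ j * b $ j')" for j j' :: 'n
  \<comment> \<open>The diagonal blocks will have entries \<open>t p_i p_i' + E i i'\<close> and
    \<open>r_j r_j' / t + F j j'\<close>, each with at most one nonzero root \<open>t\<close>. If
    \<open>F j j' = 0\<close> there is no root, and the quotient is the already excluded 0.\<close>
  let ?T = "{0} \<union> (\<lambda>(i, i'). - E i i' / (p i * p i')) ` UNIV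
    \<union> (\<lambda>(j, j'). - (r $ j * r $ j') / F j j') ` UNIV"
  have "finite ?T" by simp
  from infinite_avoids_finite[OF inf this] obtain t where t: "t \<in> X" "t \<notin> ?T" by blast
  have t0: "t \<noteq> 0" using t(2) by simp
  then have t_inv: "inverse t * (t * x) = x" for x by (simp add: mult.assoc[symmetric])
  \<comment> \<open>The factor \<open>t\<close> sits on the row part only, so in the off-diagonal
    block it cancels against the weight \<open>inverse t\<close>.\<close>
  define y where "y = (\<chi> v. case v of Inl i \<Rightarrow> t * p i | Inr j \<Rightarrow> r $ j)"
  define z where "z b = (\<chi> v. case v of Inl i \<Rightarrow> k i b | Inr j \<Rightarrow> b $ j)" for b
  show thesis
  proof (rule that[of t S y z])
    show "t \<in> X" "finite S" by fact+
    show "Suc (card S) \<le> rank B" using less S(4) by simp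
    show "gram (inverse t) y S z $ Inl i $ Inr j = B $ i $ j" for i j
    proof -
      have "B $ i $ j = row i B $ j" by (simp add: row_def)
      also have "\<dots> = p i * r $ j + (\<Sum>b\<in>S. k i b * b $ j)" by (simp add: c_row k)
      finally show ?thesis by (simp add: gram_def y_def z_def t_inv)
    qed
    show "gram (inverse t) y S z $ Inl i $ Inl i' \<noteq> 0" for i i'
    proof
      assume "gram (inverse t) y S z $ Inl i $ Inl i' = 0"
      then have "p i * (t * p i') + E i i' = 0"
        by (simp add: gram_def y_def z_def E_def t_inv)
      then have "t * (p i * p i') + E i i' = 0" by (simp add: mult.left_commute)
      then have "t = - E i i' / (p i * p i')"
        using p_nz by (metis add_eq_0_iff2 eq_divide_eq mult_eq_0_iff)
      with t(2) show False by auto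
    qed
    show "gram (inverse t) y S z $ Inr j $ Inr j' \<noteq> 0" for j j'
    proof
      assume "gram (inverse t) y S z $ Inr j $ Inr j' = 0"
      then have *: "inverse t * (r $ j * r $ j') + F j j' = 0"
        by (simp add: gram_def y_def z_def F_def mult_ac)
      then have "F j j' \<noteq> 0" using t0 r_nz by auto
      moreover have "t * F j j' = - (r $ j * r $ j')"
      proof -
        have "t * (inverse t * (r $ j * r $ j') + F j j') = 0" using * by simp
        then have "r $ j * r $ j' + t * F j j' = 0"
          using t0 by (simp add: distrib_left mult.assoc[symmetric])
        then show ?thesis by (simp add: add_eq_0_iff)
      qed
      ultimately have "t = - (r $ j * r $ j') / F j j'" by (metis eq_divide_eq)
      with t(2) show False by auto
    qed
  qed
qed

section \<open>Triangles and their composition\<close>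

lemma triangle_empty: "triangle Y {} {}"
  by (simp add: triangle_def bij_betw_def)

lemma triangle_singleton:
  assumes "Y $ r $ c"
  shows "triangle Y {r} {c}"
  unfolding triangle_def
proof (intro conjI exI)
  show "bij_betw (\<lambda>_. r) {..<card {r}} {r}" "bij_betw (\<lambda>_. c) {..<card {c}} {c}"
    by (auto simp: bij_betw_def inj_on_def)
qed (use assms in auto)

lemma triangle_row_nonzero:
  assumes "triangle Y R C" "r \<in> R"
  shows "\<exists>c\<in>C. Y $ r $ c"
proof -
  obtain \<rho> \<sigma> where *: "\<rho> ` {..<card R} = R" "\<sigma> ` {..<card R} = C" "\<And>i. i < card R \<Longrightarrow> Y $ \<rho> i $ \<sigma> i"
    using assms(1) unfolding triangle_def bij_betw_def by auto
  then obtain i where "i < card R" "r = \<rho> i" using assms(2) by blast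
  with * show ?thesis by blast
qed

lemma triangle_column_nonzero:
  assumes "triangle Y R C" "c \<in> C"
  shows "\<exists>r\<in>R. Y $ r $ c"
proof -
  obtain \<rho> \<sigma> where *: "\<rho> ` {..<card R} = R" "\<sigma> ` {..<card R} = C" "\<And>i. i < card R \<Longrightarrow> Y $ \<rho> i $ \<sigma> i"
    using assms(1) unfolding triangle_def bij_betw_def by auto
  then obtain i where "i < card R" "c = \<sigma> i" using assms(2) by blast
  with * show ?thesis by blast
qed

lemma bij_betw_append:
  fixes f g :: "nat \<Rightarrow> 'b"
  assumes "bij_betw f {..<k} A" "bij_betw g {..<l} B" "A \<inter> B = {}"
  shows "bij_betw (\<lambda>i. if i < k then f i else g (i - k)) {..<k + l} (A \<union> B)"
proof -
  let ?h = "\<lambda>i. if i < k then f i else g (i - k)"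
  have "bij_betw ?h {..<k} A"
    using assms(1) bij_betw_cong[of "{..<k}" f ?h A] by simp
  moreover have "bij_betw (\<lambda>i. i - k) {k..<k + l} {..<l}"
    by (rule bij_betw_byWitness[where f' = "\<lambda>i. i + k"]) auto
  then have "bij_betw (g \<circ> (\<lambda>i. i - k)) {k..<k + l} B"
    using assms(2) by (rule bij_betw_trans)
  then have "bij_betw ?h {k..<k + l} B"
    by (rule bij_betw_cong[THEN iffD1, rotated]) auto
  ultimately have "bij_betw ?h ({..<k} \<union> {k..<k + l}) (A \<union> B)"
    using assms(3) by (rule bij_betw_combine)
  moreover have "{..<k} \<union> {k..<k + l} = {..<k + l}" by auto
  ultimately show ?thesis by simp
qed

text \<open>Listing the first triangle before the second puts the zero block above the diagonal. A
  shared row would have a \<open>*\<close> in \<open>C2\<close>, and a shared column a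
  \<open>*\<close> in \<open>R1\<close>, so the pieces are disjoint.\<close>

lemma triangle_union:
  assumes T1: "triangle Y R1 C1" and T2: "triangle Y R2 C2"
    and zero: "\<And>r c. r \<in> R1 \<Longrightarrow> c \<in> C2 \<Longrightarrow> \<not> Y $ r $ c"
  shows "triangle Y (R1 \<union> R2) (C1 \<union> C2)" "card (R1 \<union> R2) = card R1 + card R2"
proof -
  have disj: "R1 \<inter> R2 = {}" "C1 \<inter> C2 = {}"
    using triangle_row_nonzero[OF T2] triangle_column_nonzero[OF T1] zero by blast+
  then show cardR: "card (R1 \<union> R2) = card R1 + card R2" by (simp add: card_Un_disjoint)
  have cardC: "card (C1 \<union> C2) = card C1 + card C2" using disj by (simp add: card_Un_disjoint)
  obtain \<rho>1 \<sigma>1 where 1: "card R1 = card C1" "bij_betw \<rho>1 {..<card R1} R1" "bij_betw \<sigma>1 {..<card C1} C1"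
      "\<And>i. i < card R1 \<Longrightarrow> Y $ \<rho>1 i $ \<sigma>1 i"
      "\<And>i j. i < card R1 \<Longrightarrow> j < card C1 \<Longrightarrow> i < j \<Longrightarrow> \<not> Y $ \<rho>1 i $ \<sigma>1 j"
    using T1 unfolding triangle_def by blast
  obtain \<rho>2 \<sigma>2 where 2: "card R2 = card C2" "bij_betw \<rho>2 {..<card R2} R2" "bij_betw \<sigma>2 {..<card C2} C2"
      "\<And>i. i < card R2 \<Longrightarrow> Y $ \<rho>2 i $ \<sigma>2 i"
      "\<And>i j. i < card R2 \<Longrightarrow> j < card C2 \<Longrightarrow> i < j \<Longrightarrow> \<not> Y $ \<rho>2 i $ \<sigma>2 j"
    using T2 unfolding triangle_def by blast
  let ?\<rho> = "\<lambda>i. if i < card R1 then \<rho>1 i else \<rho>2 (i - card R1)"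
  let ?\<sigma> = "\<lambda>i. if i < card C1 then \<sigma>1 i else \<sigma>2 (i - card C1)"
  show "triangle Y (R1 \<union> R2) (C1 \<union> C2)"
    unfolding triangle_def cardR cardC
  proof (intro conjI exI allI impI)
    show "card R1 + card R2 = card C1 + card C2" using 1(1) 2(1) by simp
    show "bij_betw ?\<rho> {..<card R1 + card R2} (R1 \<union> R2)"
      using 1(2) 2(2) disj(1) by (rule bij_betw_append)
    show "bij_betw ?\<sigma> {..<card C1 + card C2} (C1 \<union> C2)"
      using 1(3) 2(3) disj(2) by (rule bij_betw_append)
  next
    fix i assume "i < card R1 + card R2"
    then show "Y $ ?\<rho> i $ ?\<sigma> i" using 1(1,4) 2(4)[of "i - card R1"] by auto
  next
    fix i j assume ij: "i < card R1 + card R2" "j < card C1 + card C2" "i < j"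
    show "\<not> Y $ ?\<rho> i $ ?\<sigma> j"
    \<comment> \<open>Outside the zero block, \<open>i < j\<close> forces both indices into the same
      triangle.\<close>
    proof (cases "i < card R1 \<and> \<not> j < card C1")
      case True
      then have "\<rho>1 i \<in> R1" "\<sigma>2 (j - card C1) \<in> C2"
        using 1(2) 2(3) ij(2) by (auto dest!: bij_betwE)
      then show ?thesis using zero True by simp
    next
      case False
      then show ?thesis
        using ij 1(1) 1(5)[of i j] 2(1) 2(5)[of "i - card R1" "j - card R1"] by auto
    qed
  qed
qed

lemma finite_triangle_sizes: "finite {card R | R C. triangle Y R C}"
  by (rule finite_subset[of _ "range card"]) auto

lemma card_le_tri: "triangle Y R C \<Longrightarrow> card R \<le> tri Y"
  unfolding tri_def by (rule Max_ge[OF finite_triangle_sizes]) blast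

lemma tri_attained: "\<exists>R C. triangle Y R C \<and> card R = tri Y"
proof -
  have "tri Y \<in> {card R | R C. triangle Y R C}"
    unfolding tri_def using triangle_empty by (intro Max_in[OF finite_triangle_sizes]) blast
  then show ?thesis by auto
qed

section \<open>Forcing numbers and comparison of the rules\<close>

lemma forcing_number_le: "(forcing_step f)\<^sup>*\<^sup>* S UNIV \<Longrightarrow> forcing_number f \<le> card S"
  unfolding forcing_number_def by (rule Least_le) blast

text \<open>The set \<open>UNIV\<close> needs no step, so the minimum is over a nonempty
  set.\<close>

lemma forcing_number_attained: "\<exists>S. card S = forcing_number f \<and> (forcing_step f)\<^sup>*\<^sup>* S UNIV"
  unfolding forcing_number_def by (rule LeastI_ex) blast

lemma forcing_number_antimono:
  assumes "\<And>F v u. g F v u \<Longrightarrow> f F v u"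
  shows "forcing_number f \<le> forcing_number g"
proof -
  have "forcing_step g \<le> forcing_step f"
    unfolding forcing_step_def using assms by (intro predicate2I) blast
  then have "(forcing_step g)\<^sup>*\<^sup>* \<le> (forcing_step f)\<^sup>*\<^sup>*" by (rule rtranclp_mono)
  with forcing_number_attained[of g] show ?thesis
    by (metis forcing_number_le predicate2D)
qed

text \<open>The forcing vertex is filled, so a loop at it adds no unfilled neighbor.\<close>

lemma standard_rule_loop_rule: "standard_rule G F v u \<Longrightarrow> loop_rule (looping G L) F v u"
  unfolding standard_rule_def loop_rule_def looping_def by blast

text \<open>The component of \<open>u\<close> consists of unfilled vertices, so \<open>u\<close> is
  also the only neighbor of \<open>v\<close> inside it.\<close>

lemma standard_rule_psd_rule:
  assumes "standard_rule G F v u"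
  shows "psd_rule G F v u"
proof -
  let ?W = "{y. (\<lambda>a b. a \<in> - F \<and> b \<in> - F \<and> G a b)\<^sup>*\<^sup>* u y}"
  have v: "v \<in> F" and u: "{w. w \<notin> F \<and> G v w} = {u}" using assms by (auto simp: standard_rule_def)
  have "?W \<subseteq> - F"
  proof
    fix y assume "y \<in> ?W"
    then show "y \<in> - F" using u by (auto elim: rtranclp.cases)
  qed
  then have "{w \<in> ?W. G v w} = {u}" using u by auto
  moreover have "?W \<in> induced_components G (- F)"
    using u unfolding induced_components_def by blast
  ultimately show ?thesis unfolding psd_rule_def using v by blast
qed

section \<open>From a forcing process to a triangle\<close>

definition unfilled_disconnected :: "('m::finite, 'n::finite) pattern \<Rightarrow> ('m + 'n) set \<Rightarrow> bool" where
  "unfilled_disconnected Y F \<longleftrightarrow> (\<forall>i j. Inl i \<notin> F \<longrightarrow> Inr j \<notin> F \<longrightarrow> \<not> Y $ i $ j)"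

text \<open>A common weakening of the loop rule for the looping at all vertices and of the positive
  semidefinite rule.\<close>

definition block_rule :: "('m::finite, 'n::finite) pattern \<Rightarrow> ('m + 'n) forcing_rule" where
  "block_rule Y F v u \<longleftrightarrow> (\<exists>W.
    (W = - F \<or> unfilled_disconnected Y F \<and> (W = - F \<inter> range Inl \<or> W = - F \<inter> range Inr)) \<and>
    {w \<in> W. looping (cobipartite_graph Y) UNIV v w} = {u})"

lemma loop_rule_block_rule:
  "loop_rule (looping (cobipartite_graph Y) UNIV) F v u \<Longrightarrow> block_rule Y F v u"
  unfolding loop_rule_def block_rule_def by (rule exI[of _ "- F"]) simp

text \<open>The unfilled part of a clique is connected. So a component is all of \<open>- F\<close>
  if a \<open>*\<close> joins an unfilled row to an unfilled column, and otherwise the unfilled part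
  of one clique. Since \<open>v\<close> is filled, its loop is invisible in
  \<open>W\<close>.\<close>

lemma psd_rule_block_rule:
  fixes Y :: "('m::finite, 'n::finite) pattern"
  assumes "psd_rule (cobipartite_graph Y) F v u"
  shows "block_rule Y F v u"
proof -
  let ?G = "cobipartite_graph Y"
  define r where "r a b \<longleftrightarrow> a \<in> - F \<and> b \<in> - F \<and> ?G a b" for a b
  have r_eq: "r = (\<lambda>a b. a \<in> - F \<and> b \<in> - F \<and> ?G a b)" by (simp add: r_def fun_eq_iff)
  obtain x where v: "v \<in> F" and x: "x \<in> - F" and u: "{w \<in> {w. r\<^sup>*\<^sup>* x w}. ?G v w} = {u}"
    using assms unfolding psd_rule_def induced_components_def r_eq by blast
  define W where "W = {w. r\<^sup>*\<^sup>* x w}"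
  have reach_F: "w \<in> - F" if "r\<^sup>*\<^sup>* x w" for w
    using that x by (cases rule: rtranclp.cases) (auto simp: r_def)
  have left: "r\<^sup>*\<^sup>* (Inl i) (Inl i')" if "Inl i \<in> - F" "Inl i' \<in> - F" for i i'
    using that by (cases "i = i'") (auto simp: r_def)
  have right: "r\<^sup>*\<^sup>* (Inr j) (Inr j')" if "Inr j \<in> - F" "Inr j' \<in> - F" for j j'
    using that by (cases "j = j'") (auto simp: r_def)
  have "W = - F \<or> unfilled_disconnected Y F \<and> (W = - F \<inter> range Inl \<or> W = - F \<inter> range Inr)"
  proof (cases "unfilled_disconnected Y F")
    case True
    \<comment> \<open>Without crossing edges a path never changes sides.\<close>
    have "isl w = isl x" if "r\<^sup>*\<^sup>* x w" for w
      using that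
    proof induction
      case (step b c)
      then show ?case using True by (cases b; cases c) (auto simp: unfilled_disconnected_def r_def)
    qed simp
    moreover have "r\<^sup>*\<^sup>* x w" if "w \<in> - F" "isl w = isl x" for w
      using that x left right by (cases w; cases x) simp_all
    ultimately have W: "w \<in> W \<longleftrightarrow> w \<in> - F \<and> isl w = isl x" for w
      unfolding W_def using reach_F by blast
    have isl: "w \<in> range Inl \<longleftrightarrow> isl w" "w \<in> range Inr \<longleftrightarrow> \<not> isl w" for w :: "'m + 'n"
      by (cases w; auto)+
    have "W = - F \<inter> range Inl" if "isl x" using that by (intro set_eqI) (simp add: W isl)
    moreover have "W = - F \<inter> range Inr" if "\<not> isl x" using that by (intro set_eqI) (simp add: W isl)
    ultimately show ?thesis using True by blast
  next
    case False
    then obtain i j where ij: "Inl i \<in> - F" "Inr j \<in> - F" "Y $ i $ j"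
      by (auto simp: unfilled_disconnected_def)
    then have lr: "r\<^sup>*\<^sup>* (Inl i) (Inr j)" "r\<^sup>*\<^sup>* (Inr j) (Inl i)" by (auto simp: r_def)
    \<comment> \<open>The crossing edge joins the two cliques, so any two unfilled vertices are
      connected through \<open>Inl i\<close>.\<close>
    have to_i: "r\<^sup>*\<^sup>* x (Inl i)"
    proof (cases x)
      case (Inl i')
      then show ?thesis using left x ij(1) by simp
    next
      case (Inr j')
      then show ?thesis using right x ij(2) lr(2) by (metis rtranclp_trans)
    qed
    have from_i: "r\<^sup>*\<^sup>* (Inl i) w" if "w \<in> - F" for w
    proof (cases w)
      case (Inl i')
      then show ?thesis using left that ij(1) by simp
    next
      case (Inr j')
      then show ?thesis using right that ij(2) lr(1) by (metis rtranclp_trans)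
    qed
    have "W = - F" unfolding W_def using reach_F rtranclp_trans[OF to_i from_i] by blast
    then show ?thesis by blast
  qed
  moreover have "{w \<in> W. looping ?G UNIV v w} = {u}"
    using u v reach_F unfolding W_def looping_def by blast
  ultimately show ?thesis unfolding block_rule_def by blast
qed

text \<open>Induction from the end of the process, where both triangles are empty. A forced row is
  appended last to the triangle on the unfilled rows; a forced column is put first in the triangle
  on the unfilled columns. The partner sets \<open>R\<close> and \<open>C\<close> are free.\<close>

lemma forcing_block_rule_triangles:
  assumes rows: "\<And>i. \<exists>j. Y $ i $ j" and columns: "\<And>j. \<exists>i. Y $ i $ j"
    and "(forcing_step (block_rule Y))\<^sup>*\<^sup>* F UNIV" and "unfilled_disconnected Y F"
  shows "\<exists>R C. triangle Y R {j. Inr j \<notin> F} \<and> triangle Y {i. Inl i \<notin> F} C"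
  using assms(3,4)
proof (induction rule: converse_rtranclp_induct)
  case base
  then show ?case using triangle_empty by auto
next
  case (step F F')
  obtain v u W where F': "F' = insert u F"
    and W: "W = - F \<or> W = - F \<inter> range Inl \<or> W = - F \<inter> range Inr"
    and u: "{w \<in> W. looping (cobipartite_graph Y) UNIV v w} = {u}"
    using step.hyps(1) by (auto simp: forcing_step_def block_rule_def)
  have "unfilled_disconnected Y F'" using step.prems by (auto simp: unfilled_disconnected_def F')
  then obtain R C where RC: "triangle Y R {j. Inr j \<notin> F'}" "triangle Y {i. Inl i \<notin> F'} C"
    using step.IH by blast
  have uF: "u \<in> W" "looping (cobipartite_graph Y) UNIV v u" "u \<notin> F" using u W by blast+
  have only: "w = u" if "w \<in> W" "looping (cobipartite_graph Y) UNIV v w" for w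
    using u that by blast
  show ?case
  proof (cases u)
    case (Inl b)
    \<comment> \<open>The possible sets \<open>W\<close> that contain a row vertex contain all
      unfilled ones.\<close>
    have W': "Inl i \<in> W" if "Inl i \<notin> F" for i using that W uF(1) Inl by auto
    \<comment> \<open>If a column forces \<open>b\<close>, it serves as \<open>c\<close> itself. If
      a row does, its clique and loop leave \<open>b\<close> as the last unfilled row, and any
      \<open>*\<close> in row \<open>b\<close> will do.\<close>
    have "\<exists>c. Y $ b $ c \<and> (\<forall>i. Inl i \<notin> F' \<longrightarrow> \<not> Y $ i $ c)"
    proof (cases v)
      case (Inl a)
      have "Inl i \<in> F'" for i
        using only[OF W', of i] Inl \<open>u = Inl b\<close> by (auto simp: looping_def F')
      then show ?thesis using rows by blast
    next
      case (Inr c)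
      have "\<not> Y $ i $ c" if "Inl i \<notin> F'" for i
        using only[OF W', of i] that Inr by (auto simp: looping_def F')
      then show ?thesis using uF(2) Inr Inl by (auto simp: looping_def)
    qed
    then obtain c where c: "Y $ b $ c" "\<And>i. Inl i \<notin> F' \<Longrightarrow> \<not> Y $ i $ c" by blast
    have "triangle Y ({i. Inl i \<notin> F'} \<union> {b}) (C \<union> {c})"
      using RC(2) triangle_singleton[of Y b c, OF c(1)] by (rule triangle_union) (use c(2) in auto)
    moreover have "{i. Inl i \<notin> F'} \<union> {b} = {i. Inl i \<notin> F}" "{j. Inr j \<notin> F'} = {j. Inr j \<notin> F}"
      using uF(3) by (auto simp: F' Inl)
    ultimately show ?thesis using RC(1) by auto
  next
    case (Inr b)
    have W': "Inr j \<in> W" if "Inr j \<notin> F" for j using that W uF(1) Inr by auto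
    \<comment> \<open>Dually, \<open>r\<close> is the forcing row, or any row with a
      \<open>*\<close> in the last unfilled column \<open>b\<close>.\<close>
    have "\<exists>r. Y $ r $ b \<and> (\<forall>j. Inr j \<notin> F' \<longrightarrow> \<not> Y $ r $ j)"
    proof (cases v)
      case (Inr a)
      have "Inr j \<in> F'" for j
        using only[OF W', of j] Inr \<open>u = Inr b\<close> by (auto simp: looping_def F')
      then show ?thesis using columns by blast
    next
      case (Inl r)
      have "\<not> Y $ r $ j" if "Inr j \<notin> F'" for j
        using only[OF W', of j] that Inl by (auto simp: looping_def F')
      then show ?thesis using uF(2) Inr Inl by (auto simp: looping_def)
    qed
    then obtain r where r: "Y $ r $ b" "\<And>j. Inr j \<notin> F' \<Longrightarrow> \<not> Y $ r $ j" by blast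
    have "triangle Y ({r} \<union> R) ({b} \<union> {j. Inr j \<notin> F'})"
      using triangle_singleton[of Y r b, OF r(1)] RC(1) by (rule triangle_union) (use r(2) in auto)
    moreover have "{b} \<union> {j. Inr j \<notin> F'} = {j. Inr j \<notin> F}" "{i. Inl i \<notin> F'} = {i. Inl i \<notin> F}"
      using uF(3) by (auto simp: F' Inr)
    ultimately show ?thesis using RC(2) by auto
  qed
qed

text \<open>In the disconnected case the two triangles are joined along the zero block between
  unfilled rows and columns. Otherwise the first force fills the last unfilled vertex of the forcing
  vertex's own clique, which reduces to the disconnected case with one more pair to be
  found.\<close>

lemma card_unfilled_le_tri:
  assumes rows: "\<And>i. \<exists>j. Y $ i $ j" and columns: "\<And>j. \<exists>i. Y $ i $ j"
    and steps: "(forcing_step (block_rule Y))\<^sup>*\<^sup>* F UNIV"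
  shows "card (- F) \<le> tri Y"
proof -
  let ?R = "\<lambda>F. {i. Inl i \<notin> F}" and ?C = "\<lambda>F. {j. Inr j \<notin> F}"
  have "w \<in> - F \<longleftrightarrow> w \<in> ?R F <+> ?C F" for w by (cases w) auto
  then have "- F = ?R F <+> ?C F" by blast
  then have card: "card (- F) = card (?R F) + card (?C F)" by (simp add: card_Plus)
  have card_eq: "card R = card C" if "triangle Y R C" for R C using that by (simp add: triangle_def)
  show ?thesis
  proof (cases "unfilled_disconnected Y F")
    case True
    then obtain R C where RC: "triangle Y R (?C F)" "triangle Y (?R F) C"
      using forcing_block_rule_triangles[OF rows columns steps] by blast
    have zero: "\<not> Y $ r $ c" if "r \<in> ?R F" "c \<in> ?C F" for r c
      using that True by (auto simp: unfilled_disconnected_def)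
    show ?thesis
      using card card_le_tri[OF triangle_union(1)[OF RC(2,1) zero]]
        triangle_union(2)[OF RC(2,1) zero] card_eq[OF RC(1)] by simp
  next
    case False
    then have "F \<noteq> UNIV" by (auto simp: unfilled_disconnected_def)
    with steps obtain F' where F': "forcing_step (block_rule Y) F F'"
      "(forcing_step (block_rule Y))\<^sup>*\<^sup>* F' UNIV"
      by (auto elim: converse_rtranclpE)
    \<comment> \<open>A \<open>*\<close> between unfilled vertices leaves only the choice
      \<open>W = - F\<close>.\<close>
    obtain v u where F'_eq: "F' = insert u F"
      and "{w \<in> - F. looping (cobipartite_graph Y) UNIV v w} = {u}"
      using F'(1) False by (auto simp: forcing_step_def block_rule_def)
    then have uF: "u \<notin> F" "looping (cobipartite_graph Y) UNIV v u"
      and only: "\<And>w. w \<notin> F \<Longrightarrow> looping (cobipartite_graph Y) UNIV v w \<Longrightarrow> w = u" by blast+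
    show ?thesis
    proof (cases v)
      case (Inl a)
      have R: "u = Inl i" if "Inl i \<notin> F" for i
        using only[of "Inl i"] that Inl by (auto simp: looping_def)
      with False obtain b where b: "u = Inl b" by (auto simp: unfilled_disconnected_def)
      have "i = b" if "Inl i \<notin> F" for i using R[OF that] b by simp
      then have RF: "?R F = {b}" using b uF(1) by blast
      have disc: "unfilled_disconnected Y F'"
        unfolding unfilled_disconnected_def F'_eq using R by blast
      obtain R where R: "triangle Y R (?C F')"
        using forcing_block_rule_triangles[OF rows columns F'(2) disc] by blast
      \<comment> \<open>The forcing row \<open>a\<close> replaces the forced row \<open>b\<close>:
        it has no \<open>*\<close> in an unfilled column, so \<open>(a, c)\<close> can precede the
        triangle on those columns.\<close>
      obtain c where c: "Y $ a $ c" using rows by blast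
      have "\<not> Y $ a $ j" if "j \<in> ?C F'" for j
        using only[of "Inr j"] that b Inl by (auto simp: looping_def F'_eq)
      then have zero: "\<not> Y $ i $ j" if "i \<in> {a}" "j \<in> ?C F'" for i j using that by auto
      have "?C F' = ?C F" by (simp add: F'_eq b)
      then show ?thesis
        using card RF card_le_tri[OF triangle_union(1)[OF triangle_singleton[of Y, OF c] R zero]]
          triangle_union(2)[OF triangle_singleton[of Y, OF c] R zero] card_eq[OF R] by simp
    next
      case (Inr a)
      have C: "u = Inr j" if "Inr j \<notin> F" for j
        using only[of "Inr j"] that Inr by (auto simp: looping_def)
      with False obtain b where b: "u = Inr b" by (auto simp: unfilled_disconnected_def)
      have "j = b" if "Inr j \<notin> F" for j using C[OF that] b by simp
      then have CF: "?C F = {b}" using b uF(1) by blast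
      have disc: "unfilled_disconnected Y F'"
        unfolding unfilled_disconnected_def F'_eq using C by blast
      obtain C where C: "triangle Y (?R F') C"
        using forcing_block_rule_triangles[OF rows columns F'(2) disc] by blast
      \<comment> \<open>Dually, \<open>(r, a)\<close> can follow the triangle on the unfilled
        rows.\<close>
      obtain r where r: "Y $ r $ a" using columns by blast
      have "\<not> Y $ i $ a" if "i \<in> ?R F'" for i
        using only[of "Inl i"] that b Inr by (auto simp: looping_def F'_eq)
      then have zero: "\<not> Y $ i $ j" if "i \<in> ?R F'" "j \<in> {a}" for i j using that by auto
      have "?R F' = ?R F" by (simp add: F'_eq b)
      then show ?thesis
        using card CF card_le_tri[OF triangle_union(1)[OF C triangle_singleton[of Y, OF r] zero]]
          triangle_union(2)[OF C triangle_singleton[of Y, OF r] zero] by simp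
    qed
  qed
qed

text \<open>The block rule is the most permissive one, so its bound carries over to every rule that
  implies it.\<close>

lemma forcing_number_plus_tri_ge:
  fixes Y :: "('m::finite, 'n::finite) pattern"
  assumes "\<And>i. \<exists>j. Y $ i $ j" "\<And>j. \<exists>i. Y $ i $ j" "\<And>F v u. f F v u \<Longrightarrow> block_rule Y F v u"
  shows "CARD('m + 'n) \<le> forcing_number f + tri Y"
proof -
  obtain S where S: "card S = forcing_number (block_rule Y)"
      "(forcing_step (block_rule Y))\<^sup>*\<^sup>* S UNIV"
    using forcing_number_attained by blast
  have "CARD('m + 'n) - card S \<le> tri Y"
    using card_unfilled_le_tri[OF assms(1,2) S(2)] by (simp add: Compl_eq_Diff_UNIV card_Diff_subset)
  moreover have "forcing_number (block_rule Y) \<le> forcing_number f"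
    using assms(3) by (rule forcing_number_antimono)
  ultimately show ?thesis using S(1) by linarith
qed

text \<open>Only the columns of a largest triangle start unfilled. The row \<open>\<rho> i\<close>
  then forces \<open>\<sigma> i\<close> at step \<open>i\<close>, as its entries in the later
  columns are zero and all rows are filled.\<close>

lemma zero_forcing_number_plus_tri_le:
  fixes Y :: "('m::finite, 'n::finite) pattern"
  shows "zero_forcing_number (cobipartite_graph Y) + tri Y \<le> CARD('m + 'n)"
proof -
  let ?G = "cobipartite_graph Y"
  obtain R C where "triangle Y R C" and k: "card R = tri Y" using tri_attained by blast
  then obtain \<rho> \<sigma> where RC: "card R = card C" "bij_betw \<rho> {..<card R} R" "bij_betw \<sigma> {..<card C} C"
      "\<And>i. i < card R \<Longrightarrow> Y $ \<rho> i $ \<sigma> i"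
      "\<And>i j. i < card R \<Longrightarrow> j < card C \<Longrightarrow> i < j \<Longrightarrow> \<not> Y $ \<rho> i $ \<sigma> j"
    unfolding triangle_def by blast
  let ?k = "card C"
  define F :: "nat \<Rightarrow> ('m + 'n) set" where "F i = - (Inr ` \<sigma> ` {i..<?k})" for i
  have "(forcing_step (standard_rule ?G))\<^sup>*\<^sup>* (F 0) (F i)" if "i \<le> ?k" for i
    using that
  proof (induction i)
    case (Suc i)
    have "{i..<?k} = insert i {Suc i..<?k}" using Suc.prems by auto
    then have image: "\<sigma> ` {i..<?k} = insert (\<sigma> i) (\<sigma> ` {Suc i..<?k})" by simp
    have "\<sigma> i \<notin> \<sigma> ` {Suc i..<?k}"
      using RC(3) Suc.prems by (fastforce simp: bij_betw_def dest: inj_onD)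
    then have "F (Suc i) = insert (Inr (\<sigma> i)) (F i)" unfolding F_def image by blast
    moreover have "standard_rule ?G (F i) (Inl (\<rho> i)) (Inr (\<sigma> i))"
      using RC(1) RC(4)[of i] RC(5)[of i] Suc.prems by (force simp: standard_rule_def F_def le_less)
    ultimately have "forcing_step (standard_rule ?G) (F i) (F (Suc i))"
      unfolding forcing_step_def by blast
    with Suc show ?case by simp
  qed simp
  from this[of ?k] have "(forcing_step (standard_rule ?G))\<^sup>*\<^sup>* (F 0) UNIV" by (simp add: F_def)
  then have "zero_forcing_number ?G \<le> card (F 0)"
    unfolding zero_forcing_number_def by (rule forcing_number_le)
  also have "F 0 = - (Inr ` C)"
    using RC(3) by (simp add: F_def bij_betw_def atLeast0LessThan)
  also have "card \<dots> = CARD('m + 'n) - tri Y"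
    using RC(1) k by (simp add: Compl_eq_Diff_UNIV card_Diff_subset card_image)
  finally have "zero_forcing_number ?G \<le> CARD('m + 'n) - tri Y" .
  \<comment> \<open>Rules out truncation in the natural number subtraction.\<close>
  moreover have "tri Y \<le> CARD('m)" using k card_mono[of UNIV R] by simp
  ultimately show ?thesis by (simp add: card_UNIV_sum)
qed

section \<open>Minimum rank and maximum nullity\<close>

lemma min_rank_le:
  fixes A :: "'a::field^'n::finite^'m::finite"
  assumes "has_pattern A Y"
  shows "min_rank TYPE('a) Y \<le> rank A"
  unfolding min_rank_def by (rule Least_le) (intro exI[of _ A] conjI refl assms)

lemma min_rank_attained:
  fixes Y :: "('m::finite, 'n::finite) pattern"
  shows "\<exists>A :: 'a::field^'n^'m. has_pattern A Y \<and> rank A = min_rank TYPE('a) Y"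
proof -
  let ?P = "\<lambda>r. \<exists>A :: 'a^'n^'m. has_pattern A Y \<and> rank A = r"
  define J :: "'a^'n^'m" where "J = (\<chi> i j. if Y $ i $ j then 1 else 0)"
  have "has_pattern J Y" by (simp add: has_pattern_def J_def)
  then have "?P (rank J)" by (intro exI[of _ J] conjI refl)
  then have "?P (LEAST r. ?P r)" by (rule LeastI[of ?P])
  then show ?thesis unfolding min_rank_def .
qed

lemma nullity_plus_min_rank_le:
  fixes Y :: "('m::finite, 'n::finite) pattern" and A :: "'a::field^('m + 'n)^('m + 'n)"
  assumes A: "A \<in> sym_matrices (cobipartite_graph Y)"
  shows "nullity A + min_rank TYPE('a) Y \<le> CARD('m + 'n)"
proof -
  define B :: "'a^'n^'m" where "B = (\<chi> i j. A $ Inl i $ Inr j)"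
  have "has_pattern B Y" using A by (auto simp: has_pattern_def B_def sym_matrices_def)
  then have "min_rank TYPE('a) Y \<le> rank B" by (rule min_rank_le)
  also have "\<dots> \<le> rank A" by (rule rank_off_diagonal_block_le) (simp add: B_def)
  finally show ?thesis using nullity_symmetric[of A] A by (simp add: sym_matrices_def)
qed

text \<open>The Gram construction for a matrix \<open>B\<close> of minimum rank: its nonzero
  diagonal blocks realize the two cliques, and its nullity bound meets the upper bound valid for all
  matrices of the graph.\<close>

lemma exists_gram_sym_matrix:
  fixes Y :: "('m::finite, 'n::finite) pattern" and X :: "'a::field set"
  assumes "infinite X" and rows: "\<And>i. \<exists>j. Y $ i $ j" and columns: "\<And>j. \<exists>i. Y $ i $ j"
  shows "\<exists>t\<in>X. \<exists>(y :: 'a^('m + 'n)) (S :: ('a^'n) set) z.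
    gram (inverse t) y S z \<in> sym_matrices (cobipartite_graph Y) \<and>
    nullity (gram (inverse t) y S z) + min_rank TYPE('a) Y = CARD('m + 'n)"
proof -
  obtain B :: "'a^'n^'m" where B: "has_pattern B Y" "rank B = min_rank TYPE('a) Y"
    using min_rank_attained by blast
  have row: "row i B \<noteq> 0" for i
    using B(1) rows[of i] by (auto simp: has_pattern_def row_def vec_eq_iff)
  have column: "column j B \<noteq> 0" for j
    using B(1) columns[of j] by (auto simp: has_pattern_def column_def vec_eq_iff)
  obtain t and y :: "'a^('m + 'n)" and S :: "('a^'n) set" and z
    where t: "t \<in> X" and S: "finite S" "Suc (card S) \<le> rank B"
      and block: "\<And>i j. gram (inverse t) y S z $ Inl i $ Inr j = B $ i $ j"
        "\<And>i i'. gram (inverse t) y S z $ Inl i $ Inl i' \<noteq> 0"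
        "\<And>j j'. gram (inverse t) y S z $ Inr j $ Inr j' \<noteq> 0"
    by (rule exists_gram_with_block[OF assms(1) row column]) (rule that)
  let ?A = "gram (inverse t) y S z"
  have block': "?A $ Inr j $ Inl i = B $ i $ j" for i j
    by (subst block(1)[symmetric]) (simp add: gram_def mult_ac)
  have "(?A $ k $ l \<noteq> 0) = cobipartite_graph Y k l" if "k \<noteq> l" for k l
    using that B(1) by (cases k; cases l) (auto simp: block block' has_pattern_def)
  then have A: "?A \<in> sym_matrices (cobipartite_graph Y)"
    by (simp add: sym_matrices_def transpose_gram)
  moreover have "nullity ?A + min_rank TYPE('a) Y = CARD('m + 'n)"
    using nullity_plus_min_rank_le[OF A] nullity_gram[OF S(1), of "inverse t" y z] S(2) B(2) by linarith
  ultimately show ?thesis using t by blast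
qed

text \<open>The predicate \<open>P\<close> lets one argument serve both all symmetric matrices of
  the graph and the positive semidefinite ones.\<close>

lemma Max_nullity_eq:
  fixes Y :: "('m::finite, 'n::finite) pattern" and A :: "'a::field^('m + 'n)^('m + 'n)"
  assumes sub: "\<And>C. P C \<Longrightarrow> C \<in> sym_matrices (cobipartite_graph Y)"
    and A: "P A" "nullity A + min_rank TYPE('a) Y = CARD('m + 'n)"
  shows "Max {nullity C | C. P C} + min_rank TYPE('a) Y = CARD('m + 'n)"
proof -
  have le: "nullity C \<le> nullity A" if "P C" for C
    using nullity_plus_min_rank_le[OF sub[OF that]] A(2) by linarith
  have "Max (nullity ` {C. P C}) = nullity A"
  proof (rule Max_eqI)
    have "nullity ` {C. P C} \<subseteq> {..nullity A}" using le by (intro image_subsetI) simp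
    then show "finite (nullity ` {C. P C})" by (rule finite_subset) simp
    show "k \<le> nullity A" if "k \<in> nullity ` {C. P C}" for k
      using that by (elim imageE) (simp add: le)
    show "nullity A \<in> nullity ` {C. P C}" using A(1) by (intro imageI) simp
  qed
  then show ?thesis using A(2) by (simp add: image_Collect)
qed

lemma max_nullity_cobipartite_graph:
  fixes Y :: "('m::finite, 'n::finite) pattern"
  assumes "infinite (UNIV :: 'a::field set)" and "\<And>i. \<exists>j. Y $ i $ j" and "\<And>j. \<exists>i. Y $ i $ j"
  shows "max_nullity TYPE('a) (cobipartite_graph Y) + min_rank TYPE('a) Y = CARD('m + 'n)"
proof -
  from exists_gram_sym_matrix[OF assms]
  obtain t :: 'a and y :: "'a^('m + 'n)" and S :: "('a^'n) set" and z where
    A: "gram (inverse t) y S z \<in> sym_matrices (cobipartite_graph Y)"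
      "nullity (gram (inverse t) y S z) + min_rank TYPE('a) Y = CARD('m + 'n)"
    by (elim bexE exE conjE)
  show ?thesis unfolding max_nullity_def using A by (rule Max_nullity_eq[rotated])
qed

lemma max_psd_nullity_cobipartite_graph:
  fixes Y :: "('m::finite, 'n::finite) pattern"
  assumes "\<And>i. \<exists>j. Y $ i $ j" and "\<And>j. \<exists>i. Y $ i $ j"
  shows "max_psd_nullity (cobipartite_graph Y) + min_rank TYPE(real) Y = CARD('m + 'n)"
proof -
  \<comment> \<open>Drawing \<open>t\<close> from the positive reals makes the weight
    \<open>inverse t\<close> nonnegative.\<close>
  have "infinite {0 :: real<..}" by (rule infinite_Ioi)
  from exists_gram_sym_matrix[OF this assms]
  obtain t :: real and y :: "real^('m + 'n)" and S :: "(real^'n) set" and z where t: "t \<in> {0<..}"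
    and A: "gram (inverse t) y S z \<in> sym_matrices (cobipartite_graph Y)"
      "nullity (gram (inverse t) y S z) + min_rank TYPE(real) Y = CARD('m + 'n)"
    by (elim bexE exE conjE)
  have "pos_semidef (gram (inverse t) y S z)" using t by (intro pos_semidef_gram) simp
  with A(1) have "gram (inverse t) y S z \<in> sym_matrices (cobipartite_graph Y) \<and>
    pos_semidef (gram (inverse t) y S z)" ..
  then show ?thesis unfolding max_psd_nullity_def using A(2)
    by (rule Max_nullity_eq[rotated]) (rule conjunct1)
qed

section \<open>The forcing numbers of the cobipartite graph, and the equivalences\<close>

lemma zero_forcing_number_cobipartite_graph:
  fixes Y :: "('m::finite, 'n::finite) pattern"
  assumes "\<And>i. \<exists>j. Y $ i $ j" and "\<And>j. \<exists>i. Y $ i $ j"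
  shows "zero_forcing_number (cobipartite_graph Y) + tri Y = CARD('m + 'n)"
proof (rule antisym)
  show "CARD('m + 'n) \<le> zero_forcing_number (cobipartite_graph Y) + tri Y"
    unfolding zero_forcing_number_def
    by (intro forcing_number_plus_tri_ge assms loop_rule_block_rule standard_rule_loop_rule)
qed (rule zero_forcing_number_plus_tri_le)

lemma psd_zero_forcing_number_cobipartite_graph:
  fixes Y :: "('m::finite, 'n::finite) pattern"
  assumes "\<And>i. \<exists>j. Y $ i $ j" and "\<And>j. \<exists>i. Y $ i $ j"
  shows "psd_zero_forcing_number (cobipartite_graph Y) + tri Y = CARD('m + 'n)"
proof (rule antisym)
  have "psd_zero_forcing_number (cobipartite_graph Y) \<le> zero_forcing_number (cobipartite_graph Y)"
    unfolding psd_zero_forcing_number_def zero_forcing_number_def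
    by (rule forcing_number_antimono) (rule standard_rule_psd_rule)
  then show "psd_zero_forcing_number (cobipartite_graph Y) + tri Y \<le> CARD('m + 'n)"
    using zero_forcing_number_plus_tri_le[of Y] by linarith
  show "CARD('m + 'n) \<le> psd_zero_forcing_number (cobipartite_graph Y) + tri Y"
    unfolding psd_zero_forcing_number_def
    by (intro forcing_number_plus_tri_ge assms psd_rule_block_rule)
qed

text \<open>No looping exceeds the zero forcing number, and the looping at all vertices attains it
  by the block rule bound.\<close>

lemma enhanced_zero_forcing_number_cobipartite_graph:
  fixes Y :: "('m::finite, 'n::finite) pattern"
  assumes "\<And>i. \<exists>j. Y $ i $ j" and "\<And>j. \<exists>i. Y $ i $ j"
  shows "enhanced_zero_forcing_number (cobipartite_graph Y) = zero_forcing_number (cobipartite_graph Y)"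
  unfolding enhanced_zero_forcing_number_def
proof (rule Max_eqI)
  let ?G = "cobipartite_graph Y"
  have le: "forcing_number (loop_rule (looping ?G L)) \<le> zero_forcing_number ?G" for L
    unfolding zero_forcing_number_def
    by (rule forcing_number_antimono) (rule standard_rule_loop_rule)
  show "k \<le> zero_forcing_number ?G"
    if "k \<in> {forcing_number (loop_rule (looping ?G L)) | L. True}" for k
    using that le by blast
  have "{forcing_number (loop_rule (looping ?G L)) | L. True} \<subseteq> {..zero_forcing_number ?G}"
    using le by blast
  then show "finite {forcing_number (loop_rule (looping ?G L)) | L. True}"
    by (rule finite_subset) simp
  have "CARD('m + 'n) \<le> forcing_number (loop_rule (looping ?G UNIV)) + tri Y"
    by (intro forcing_number_plus_tri_ge assms loop_rule_block_rule)
  then have "forcing_number (loop_rule (looping ?G UNIV)) = zero_forcing_number ?G"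
    using le[of UNIV] zero_forcing_number_plus_tri_le[of Y] by linarith
  from this[symmetric]
  show "zero_forcing_number ?G \<in> {forcing_number (loop_rule (looping ?G L)) | L. True}" by blast
qed

theorem theorem4p18:
  fixes Y :: "('m::finite, 'n::finite) pattern" and G :: "('m + 'n) graph"
  assumes "G = cobipartite_graph Y"
    and "saturated G (range Inl) (range Inr)"
    and "infinite (UNIV :: 'a::field set)"
  shows "(min_rank TYPE('a) Y = tri Y \<longleftrightarrow> max_nullity TYPE('a) G = zero_forcing_number G) \<and>
    (max_nullity TYPE('a) G = zero_forcing_number G \<longleftrightarrow>
       max_nullity TYPE('a) G = enhanced_zero_forcing_number G) \<and>
    (min_rank TYPE(real) Y = tri Y \<longleftrightarrow> max_psd_nullity G = psd_zero_forcing_number G) \<and>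
    (max_nullity TYPE(real) G = zero_forcing_number G \<longleftrightarrow>
       max_psd_nullity G = psd_zero_forcing_number G) \<and>
    (max_nullity TYPE(real) G = enhanced_zero_forcing_number G \<longleftrightarrow>
       max_psd_nullity G = psd_zero_forcing_number G)"
proof -
  have rows: "\<exists>j. Y $ i $ j" for i
  proof -
    obtain w where "w \<in> range Inr" "G (Inl i) w" using assms(2) unfolding saturated_def by blast
    then show ?thesis using assms(1) by auto
  qed
  have columns: "\<exists>i. Y $ i $ j" for j
  proof -
    obtain w where "w \<in> range Inl" "G (Inr j) w" using assms(2) unfolding saturated_def by blast
    then show ?thesis using assms(1) by auto
  qed
  \<comment> \<open>Each nullity is \<open>CARD('m + 'n)\<close> minus a minimum rank and each
    forcing number is \<open>CARD('m + 'n)\<close> minus \<open>tri Y\<close>, so every equality in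
    the claim says that the minimum rank over the field in question is \<open>tri Y\<close>.\<close>
  note eqs = max_nullity_cobipartite_graph[OF assms(3) rows columns]
    max_nullity_cobipartite_graph[OF infinite_UNIV_char_0[where 'a = real] rows columns]
    max_psd_nullity_cobipartite_graph[OF rows columns]
    zero_forcing_number_cobipartite_graph[OF rows columns]
    psd_zero_forcing_number_cobipartite_graph[OF rows columns]
    enhanced_zero_forcing_number_cobipartite_graph[OF rows columns]
  show ?thesis using eqs unfolding assms(1) by (intro conjI iffI) linarith+
qed

end
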